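(* Let $p,q,k,m$ be natural numbers with $k\le p\le q\le m$. If $${m\brack p}\cdot 2^{-{p\brack k}}+{m\brack q}\cdot 2^{-{q\brack k}}<1,$$ then $\mathcal{R}_1(p,q,k)>m$.
   Context: $T_n=n(n+1)/2$, $T_0=0$. A finite set $X\subseteq\mathbb{N}$ with $|X|=T_n$, enumerated $x_1<\dots<x_{T_n}$, has $i$-th level $\{x_{T_{i-1}+1},\dots,x_{T_i}\}$ for $1\le i\le n$; $\triangle_n$ is the set of all such sets. For such sets, $X\le Y$ means $X\subseteq Y$ and every level of $X$ is contained in a single level of $Y$, distinct levels of $X$ being contained in distinct levels of $Y$; $\triangle_k(B)=\{Z\in\triangle_k:Z\le B\}$. For natural numbers $k\le p,q$, a completed game of Mines$_m(p,q,k)$ is a partition $\triangle_k(B)=X\sqcup Y$ with $B\in\triangle_m$; it is a win for player one if there is $Z\in\triangle_p(B)$ with $\triangle_k(Z)\subseteq X$, a win for player two if there is $Z\in\triangle_q(B)$ with $\triangle_k(Z)\subseteq Y$, and a draw otherwise. $\mathcal{R}_1(p,q,k)$ is the least $m\ge\max(p,q)$ such that no completed game of Mines$_m(p,q,k)$ is a draw. The numbers ${n\brack k}$ are defined by ${n\brack0}={n\brack n}=1$ and ${n\brack k}={n-1\brack k}+\binom nk{n-1\brack k-1}$ for $0<k<n$. *)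

theory Defs
  imports Complex_Main
begin

definition tri :: "nat \<Rightarrow> nat" where
  "tri n = n * (n + 1) div 2"

definition triangles :: "nat \<Rightarrow> nat set set" where
  "triangles n = {X. finite X \<and> card X = tri n}"

text \<open>Levels are numbered from 1, as are the elements \<open>x\<^sub>1 < x\<^sub>2 < \<dots>\<close> of a triangle, whereas
  list positions start at 0: hence the half-open interval, shifted by one.\<close>

definition level :: "nat set \<Rightarrow> nat \<Rightarrow> nat set" where
  "level X i = (\<lambda>j. sorted_list_of_set X ! j) ` {tri (i - 1)..<tri i}"

text \<open>\<open>tri_le k X m Y\<close> is the relation \<open>X \<le> Y\<close> for \<open>X \<in> triangles k\<close> and \<open>Y \<in> triangles m\<close>. The
  numbers of levels are passed explicitly; \<open>f\<close> sends each level of \<open>X\<close> to the level of \<open>Y\<close>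
  that contains it.\<close>

definition tri_le :: "nat \<Rightarrow> nat set \<Rightarrow> nat \<Rightarrow> nat set \<Rightarrow> bool" where
  "tri_le k X m Y \<longleftrightarrow> X \<subseteq> Y \<and>
     (\<exists>f. inj_on f {1..k} \<and> (\<forall>i\<in>{1..k}. f i \<in> {1..m} \<and> level X i \<subseteq> level Y (f i)))"

text \<open>\<open>subtriangles k m B\<close> is \<open>\<triangle>\<^sub>k(B)\<close> for \<open>B \<in> triangles m\<close>.\<close>

definition subtriangles :: "nat \<Rightarrow> nat \<Rightarrow> nat set \<Rightarrow> nat set set" where
  "subtriangles k m B = {Z \<in> triangles k. tri_le k Z m B}"

definition completed_game :: "nat \<Rightarrow> nat \<Rightarrow> nat set \<Rightarrow> nat set set \<Rightarrow> nat set set \<Rightarrow> bool" where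
  "completed_game m k B X Y \<longleftrightarrow>
     B \<in> triangles m \<and> X \<union> Y = subtriangles k m B \<and> X \<inter> Y = {}"

text \<open>A player owning the set \<open>W\<close> of \<open>k\<close>-triangles wins with goal \<open>r\<close>; the goal is \<open>p\<close> for player
  one and \<open>q\<close> for player two.\<close>

definition wins :: "nat \<Rightarrow> nat \<Rightarrow> nat \<Rightarrow> nat set \<Rightarrow> nat set set \<Rightarrow> bool" where
  "wins r k m B W \<longleftrightarrow> (\<exists>Z \<in> subtriangles r m B. subtriangles k r Z \<subseteq> W)"

definition draw :: "nat \<Rightarrow> nat \<Rightarrow> nat \<Rightarrow> nat \<Rightarrow> nat set \<Rightarrow> nat set set \<Rightarrow> nat set set \<Rightarrow> bool" where
  "draw p q k m B X Y \<longleftrightarrow> \<not> wins p k m B X \<and> \<not> wins q k m B Y"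

definition R1 :: "nat \<Rightarrow> nat \<Rightarrow> nat \<Rightarrow> nat" where
  "R1 p q k = (LEAST m. max p q \<le> m \<and>
     \<not> (\<exists>B X Y. completed_game m k B X Y \<and> draw p q k m B X Y))"

text \<open>The defining recursion covers \<open>k \<le> n\<close>; for \<open>k > n\<close> the value is set to 0.\<close>

fun bracket :: "nat \<Rightarrow> nat \<Rightarrow> nat" where
  "bracket n k =
     (if k = 0 \<or> k = n then 1
      else if k < n then bracket (n - 1) k + (n choose k) * bracket (n - 1) (k - 1)
      else 0)"

declare bracket.simps [simp del]

end

theory Submission
  imports Defs "HOL-Library.Ramsey" "HOL-Library.Disjoint_Sets"
begin

text \<open>The winning sets of the two players are at most \<open>bracket m p\<close> sets of size
  \<open>bracket p k\<close> and at most \<open>bracket m q\<close> sets of size \<open>bracket q k\<close>. Hence a random completed game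
  on \<open>B\<close> is not a draw with probability at most the left-hand side of the hypothesis, and that
  quantity increases with \<open>m\<close>, so there is a draw for every smaller board with at least \<open>q\<close> levels
  as well.

  This bounds \<open>R1 p q k\<close> only once the set in its definition is known to be nonempty, since \<open>LEAST\<close>
  of an empty predicate is an unspecified number. Nonemptiness is a Ramsey theorem for
  triangles. By the product Ramsey theorem, \<open>N\<close> sufficiently large levels can be shrunk so that
  the colour of a \<open>k\<close>-triangle depends only on which \<open>k\<close> of these levels it meets; the finite
  Ramsey theorem for \<open>k\<close>-subsets of \<open>{..<N}\<close> then finishes the argument.\<close>

section \<open>Triangles and their levels\<close>

lemma tri_Suc: "tri (Suc n) = tri n + Suc n"
  by (simp add: tri_def)

lemma tri_0 [simp]: "tri 0 = 0"
  by (simp add: tri_def)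

lemma tri_mono: "i \<le> j \<Longrightarrow> tri i \<le> tri j"
  by (rule lift_Suc_mono_le [of tri]) (auto simp: tri_Suc)

text \<open>Characterises the level sequences of \<open>k\<close>-triangles without enumerating
  elements: by \<open>level_stacked\<close>, \<open>UN_level\<close> and \<open>UN_stacked\<close>,
  taking levels and taking unions are inverse to each other on the indices
  \<open>{1..k}\<close>.\<close>

definition stacked :: "nat \<Rightarrow> (nat \<Rightarrow> nat set) \<Rightarrow> bool" where
  "stacked k U \<longleftrightarrow> (\<forall>i\<in>{1..k}. finite (U i) \<and> card (U i) = i) \<and>
     (\<forall>i\<in>{1..k}. \<forall>j\<in>{1..k}. i < j \<longrightarrow> (\<forall>x\<in>U i. \<forall>y\<in>U j. x < y))"

lemma stacked_finite: "stacked k U \<Longrightarrow> i \<in> {1..k} \<Longrightarrow> finite (U i)"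
  and stacked_card: "stacked k U \<Longrightarrow> i \<in> {1..k} \<Longrightarrow> card (U i) = i"
  and stacked_less:
    "stacked k U \<Longrightarrow> i \<in> {1..k} \<Longrightarrow> j \<in> {1..k} \<Longrightarrow> i < j \<Longrightarrow> x \<in> U i \<Longrightarrow> y \<in> U j \<Longrightarrow> x < y"
  unfolding stacked_def by blast+

lemma stacked_nonempty: "stacked k U \<Longrightarrow> i \<in> {1..k} \<Longrightarrow> U i \<noteq> {}"
  by (frule (1) stacked_card) auto

lemma stacked_index_unique:
  assumes "stacked k U" "i \<in> {1..k}" "j \<in> {1..k}" "x \<in> U i" "x \<in> U j"
  shows "i = j"
  using assms stacked_less [of k U i j x x] stacked_less [of k U j i x x]
  by (metis nat_neq_iff)

lemma level_stacked:
  assumes "X \<in> triangles k"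
  shows "stacked k (level X)"
proof -
  let ?xs = "sorted_list_of_set X"
  have len: "length ?xs = tri k"
    using assms by (simp add: triangles_def)
  have srt: "?xs ! a < ?xs ! b" if "a < b" "b < tri k" for a b
    using that len sorted_wrt_nth_less [OF strict_sorted_list_of_set [of X]] by simp
  have "finite (level X i) \<and> card (level X i) = i" if i: "i \<in> {1..k}" for i
  proof -
    have "tri i \<le> tri k"
      using i by (intro tri_mono) auto
    then have "inj_on (\<lambda>j. ?xs ! j) {tri (i - 1)..<tri i}"
      using len by (auto intro!: inj_onI simp: nth_eq_iff_index_eq)
    then have "card (level X i) = tri i - tri (i - 1)"
      by (simp add: level_def card_image)
    also have "\<dots> = i"
      using i tri_Suc [of "i - 1"] by simp
    finally show ?thesis
      by (simp add: level_def)
  qed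
  moreover have "x < y" if ij: "i \<in> {1..k}" "j \<in> {1..k}" "i < j" and x: "x \<in> level X i"
    and y: "y \<in> level X j" for i j x y
  proof -
    obtain a b where a: "x = ?xs ! a" "a < tri i" and b: "y = ?xs ! b" "tri (j - 1) \<le> b" "b < tri j"
      using x y by (auto simp: level_def)
    have "tri i \<le> tri (j - 1)" "tri j \<le> tri k"
      using ij by (auto intro!: tri_mono)
    then show ?thesis
      using srt [of a b] a b by simp
  qed
  ultimately show ?thesis
    by (auto simp: stacked_def)
qed

lemma UN_level:
  assumes "X \<in> triangles k"
  shows "\<Union>(level X ` {1..k}) = X"
proof -
  have "(\<Union>i\<in>{1..n}. {tri (i - 1)..<tri i}) = {0..<tri n}" for n
  proof (induction n)
    case (Suc n)
    then show ?case
      by (simp add: atLeastAtMostSuc_conv Un_commute tri_Suc ivl_disj_un)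
  qed simp
  then have "\<Union>(level X ` {1..k}) = (\<lambda>j. sorted_list_of_set X ! j) ` {0..<tri k}"
    unfolding level_def by (metis image_UN)
  also have "\<dots> = set (sorted_list_of_set X)"
    using assms by (simp add: triangles_def nth_image [symmetric] flip: atLeast0LessThan)
      (metis length_sorted_list_of_set nth_image order_refl set_sorted_list_of_set take_all)
  also have "\<dots> = X"
    using assms by (simp add: triangles_def)
  finally show ?thesis .
qed

lemma stacked_Suc: "stacked (Suc k) U \<Longrightarrow> stacked k U"
  unfolding stacked_def by (meson atLeastAtMost_iff le_SucI)

lemma UN_1_Suc: "\<Union>(U ` {1..Suc k}) = \<Union>(U ` {1..k}) \<union> U (Suc k)"
  by (simp add: atLeastAtMostSuc_conv Un_commute)

text \<open>Induction on \<open>k\<close>: the new level lies above all earlier ones, so the sorted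
  list of the union is a concatenation whose first \<open>tri k\<close> positions hold the old
  triangle and whose remaining positions hold the new level.\<close>

lemma UN_stacked:
  assumes "stacked k U"
  shows "\<Union>(U ` {1..k}) \<in> triangles k" 
    and "i \<in> {1..k} \<Longrightarrow> level (\<Union>(U ` {1..k})) i = U i"
proof -
  have "\<Union>(U ` {1..k}) \<in> triangles k \<and> (\<forall>i\<in>{1..k}. level (\<Union>(U ` {1..k})) i = U i)"
    using assms
  proof (induction k)
    case 0
    then show ?case
      by (simp add: triangles_def)
  next
    case (Suc k)
    let ?X = "\<Union>(U ` {1..k})" and ?Y = "\<Union>(U ` {1..Suc k})" and ?V = "U (Suc k)"
    have IH: "?X \<in> triangles k" "\<And>i. i \<in> {1..k} \<Longrightarrow> level ?X i = U i"
      using Suc.IH [OF stacked_Suc [OF Suc.prems]] by auto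
    have fin: "finite ?X" "card ?X = tri k" and V: "finite ?V" "card ?V = Suc k"
      using IH(1) Suc.prems by (auto simp: triangles_def stacked_def)
    have lt: "x < y" if "x \<in> ?X" "y \<in> ?V" for x y
    proof -
      obtain i where "i \<in> {1..k}" "x \<in> U i"
        using \<open>x \<in> ?X\<close> by blast
      then show ?thesis
        using stacked_less [OF Suc.prems, of i "Suc k" x y] \<open>y \<in> ?V\<close> by simp
    qed
    note Y = UN_1_Suc [of U k]
    have disj: "?X \<inter> ?V = {}"
      using lt by blast
    have tri: "?Y \<in> triangles (Suc k)"
      unfolding Y triangles_def using fin V disj by (simp add: card_Un_disjoint tri_Suc)
    have "sorted_wrt (<) (sorted_list_of_set ?X @ sorted_list_of_set ?V)"
      using lt fin V by (simp add: sorted_wrt_append)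
    then have L: "sorted_list_of_set ?Y = sorted_list_of_set ?X @ sorted_list_of_set ?V"
      using fin V unfolding Y
      by (intro strict_sorted_equal) auto
    have "level ?Y i = U i" if i: "i \<in> {1..Suc k}" for i
    proof (cases "i = Suc k")
      case True
      have "level ?Y i = (\<lambda>j. sorted_list_of_set ?V ! (j - tri k)) ` {tri k..<tri k + Suc k}"
        unfolding level_def L using True fin(2)
        by (auto simp: nth_append tri_Suc)
      also have "\<dots> = (!) (sorted_list_of_set ?V) ` {0..<Suc k}"
      proof -
        have shift: "{tri k..<tri k + Suc k} = (+) (tri k) ` {0..<Suc k}"
          by (simp add: add.commute)
        show ?thesis
          unfolding shift by (simp only: image_image add_diff_cancel_left')
      qed
      also have "\<dots> = set (sorted_list_of_set ?V)"
        using V by (simp add: nth_image)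
      finally show ?thesis
        using True V by simp
    next
      case False
      then have "tri i \<le> tri k"
        using i by (intro tri_mono) auto
      then have "level ?Y i = level ?X i"
        unfolding level_def L using fin(2)
        by (intro image_cong) (auto simp: nth_append)
      then show ?thesis
        using IH(2) [of i] False i by simp
    qed
    then show ?case
      using tri by blast
  qed
  then show "\<Union>(U ` {1..k}) \<in> triangles k" 
    and "i \<in> {1..k} \<Longrightarrow> level (\<Union>(U ` {1..k})) i = U i"
    by auto
qed

section \<open>Subtriangles as choices of subsets of levels\<close>

lemma stacked_refine:
  assumes "stacked m L" "strict_mono_on {1..k} f" "f \<in> {1..k} \<rightarrow> {1..m}"
    "\<And>i. i \<in> {1..k} \<Longrightarrow> U i \<in> [L (f i)]\<^bsup>i\<^esup>"
  shows "stacked k U"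
proof -
  have "x < y" if "i \<in> {1..k}" "j \<in> {1..k}" "i < j" "x \<in> U i" "y \<in> U j" for i j x y
  proof (rule stacked_less [OF assms(1)])
    show "f i \<in> {1..m}" "f j \<in> {1..m}" "f i < f j"
      using that assms(2,3) by (auto simp: strict_mono_on_def)
    show "x \<in> L (f i)" "y \<in> L (f j)"
      using that assms(4) [OF that(1)] assms(4) [OF that(2)] by (auto simp: nsets_def)
  qed
  moreover have "finite (U i) \<and> card (U i) = i" if "i \<in> {1..k}" for i
    using assms(4) [OF that] by (simp add: nsets_def)
  ultimately show ?thesis
    unfolding stacked_def by blast
qed

text \<open>The map in \<open>tri_le\<close> is only assumed injective, but levels are nonempty and
  ordered, so it must be increasing. Conversely, subsets chosen from increasing levels are stacked,
  and \<open>UN_stacked\<close> identifies them as the levels of their union.\<close>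

lemma subtriangles_iff:
  assumes B: "B \<in> triangles m"
  shows "Z \<in> subtriangles k m B \<longleftrightarrow>
    (\<exists>f U. strict_mono_on {1..k} f \<and> f \<in> {1..k} \<rightarrow> {1..m} \<and>
       (\<forall>i\<in>{1..k}. U i \<in> [level B (f i)]\<^bsup>i\<^esup>) \<and> Z = \<Union>(U ` {1..k}))"
    (is "_ \<longleftrightarrow> ?R")
proof
  assume "Z \<in> subtriangles k m B"
  then obtain f where Z: "Z \<in> triangles k" and inj: "inj_on f {1..k}"
    and f: "\<And>i. i \<in> {1..k} \<Longrightarrow> f i \<in> {1..m} \<and> level Z i \<subseteq> level B (f i)"
    by (auto simp: subtriangles_def tri_le_def)
  note SZ = level_stacked [OF Z] and SB = level_stacked [OF B]
  have "f i < f j" if ij: "i \<in> {1..k}" "j \<in> {1..k}" "i < j" for i j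
  proof (rule ccontr)
    assume "\<not> f i < f j"
    moreover have "f i \<noteq> f j"
      using inj ij by (auto dest: inj_onD)
    ultimately have "f j < f i"
      by simp
    obtain x where x: "x \<in> level Z i"
      using stacked_nonempty [OF SZ ij(1)] by blast
    obtain y where y: "y \<in> level Z j"
      using stacked_nonempty [OF SZ ij(2)] by blast
    have "x < y"
      using stacked_less [OF SZ ij x y] .
    moreover have "y < x"
      using f [OF ij(1)] f [OF ij(2)] x y \<open>f j < f i\<close> stacked_less [OF SB, of "f j" "f i" y x]
      by blast
    ultimately show False
      by simp
  qed
  then have "strict_mono_on {1..k} f"
    by (auto simp: strict_mono_on_def)
  moreover have "level Z i \<in> [level B (f i)]\<^bsup>i\<^esup>" if "i \<in> {1..k}" for i
    using that f stacked_finite [OF SZ that] stacked_card [OF SZ that] by (auto simp: nsets_def)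
  ultimately show ?R
    using f UN_level [OF Z] by blast
next
  assume ?R
  then obtain f U where f: "strict_mono_on {1..k} f" "f \<in> {1..k} \<rightarrow> {1..m}"
    and U: "\<And>i. i \<in> {1..k} \<Longrightarrow> U i \<in> [level B (f i)]\<^bsup>i\<^esup>" and Z: "Z = \<Union>(U ` {1..k})"
    by blast
  have S: "stacked k U"
    using stacked_refine [OF level_stacked [OF B] f U] .
  have "U i \<subseteq> level B (f i)" "f i \<in> {1..m}" if "i \<in> {1..k}" for i
    using U [OF that] f(2) that by (auto simp: nsets_def)
  then have "Z \<subseteq> \<Union>(level B ` {1..m})" "\<forall>i\<in>{1..k}. f i \<in> {1..m} \<and> level Z i \<subseteq> level B (f i)"
    unfolding Z using UN_stacked(2) [OF S] by blast+
  moreover have "inj_on f {1..k}"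
    using f(1) strict_mono_on_imp_inj_on by blast
  ultimately show "Z \<in> subtriangles k m B"
    unfolding subtriangles_def tri_le_def
    using UN_level [OF B] UN_stacked(1) [OF S] Z by blast
qed

text \<open>The two level maps compose. This is what makes every winning set a set of triangles of
  the board.\<close>

lemma subtriangles_trans:
  assumes "Z \<in> subtriangles p m B"
  shows "subtriangles k p Z \<subseteq> subtriangles k m B"
proof
  fix W assume "W \<in> subtriangles k p Z"
  then obtain f where W: "W \<in> triangles k" "W \<subseteq> Z" "inj_on f {1..k}"
    and f: "\<forall>i\<in>{1..k}. f i \<in> {1..p} \<and> level W i \<subseteq> level Z (f i)"
    by (auto simp: subtriangles_def tri_le_def)
  obtain g where Z: "Z \<subseteq> B" "inj_on g {1..p}"
    and g: "\<forall>i\<in>{1..p}. g i \<in> {1..m} \<and> level Z i \<subseteq> level B (g i)"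
    using assms by (auto simp: subtriangles_def tri_le_def)
  have "inj_on (g \<circ> f) {1..k}"
    using W(3) f by (intro comp_inj_on inj_on_subset [OF Z(2)]) auto
  moreover have "\<forall>i\<in>{1..k}. (g \<circ> f) i \<in> {1..m} \<and> level W i \<subseteq> level B ((g \<circ> f) i)"
    using f g by fastforce
  ultimately show "W \<in> subtriangles k m B"
    unfolding subtriangles_def tri_le_def using W Z(1) by blast
qed

section \<open>Counting subtriangles by \<open>bracket\<close>\<close>

lemma bracket_0 [simp]: "bracket n 0 = 1"
  and bracket_self [simp]: "bracket n n = 1"
  and bracket_less [simp]: "n < k \<Longrightarrow> bracket n k = 0"
  by (simp_all add: bracket.simps)

text \<open>The default value 0 extends the recursion to all \<open>n\<close> and \<open>k\<close>:
  for \<open>k = n\<close> the first summand vanishes and the second is 1, for \<open>k > n\<close>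
  both sides vanish.\<close>

lemma bracket_Suc_Suc:
  "bracket (Suc n) (Suc k) = bracket n (Suc k) + (Suc n choose Suc k) * bracket n k"
  by (cases "k = n"; cases "k < n") (simp_all add: bracket.simps [of "Suc n" "Suc k"])

lemma bracket_mono:
  assumes "m \<le> n"
  shows "bracket m k \<le> bracket n k"
  using assms
proof (rule lift_Suc_mono_le [of "\<lambda>m. bracket m k", rotated])
  show "bracket n k \<le> bracket (Suc n) k" for n
    by (cases k) (simp_all add: bracket_Suc_Suc)
qed

text \<open>The \<open>k\<close>-triangles below levels \<open>L 1, \<dots>, L m\<close>, by a recursion matching that of \<open>bracket\<close>:
  either level \<open>m\<close> is avoided or it contains the last level of the triangle.\<close>

fun selections :: "(nat \<Rightarrow> nat set) \<Rightarrow> nat \<Rightarrow> nat \<Rightarrow> nat set set" where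
  "selections L 0 m = {{}}"
| "selections L (Suc k) 0 = {}"
| "selections L (Suc k) (Suc m) = selections L (Suc k) m \<union>
     (\<lambda>(Z, V). Z \<union> V) ` (selections L k m \<times> [L (Suc m)]\<^bsup>Suc k\<^esup>)"

lemma selections_Suc_Suc_iff:
  "Z \<in> selections L (Suc k) (Suc m) \<longleftrightarrow> Z \<in> selections L (Suc k) m \<or>
     (\<exists>Y\<in>selections L k m. \<exists>V\<in>[L (Suc m)]\<^bsup>Suc k\<^esup>. Z = Y \<union> V)"
  by (auto simp: image_iff)

lemma selections_subset: "Z \<in> selections L k m \<Longrightarrow> Z \<subseteq> \<Union>(L ` {1..m})"
proof (induction L k m arbitrary: Z rule: selections.induct)
  case (3 L k m)
  from "3.prems" consider "Z \<in> selections L (Suc k) m"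
    | Y V where "Y \<in> selections L k m" "V \<subseteq> L (Suc m)" "Z = Y \<union> V"
    by (auto simp: nsets_def)
  then show ?case
  proof cases
    case 1
    then show ?thesis
      using "3.IH"(1) [of Z] by fastforce
  next
    case (2 Y V)
    then show ?thesis
      using "3.IH"(2) [of Y] by fastforce
  qed
qed auto

text \<open>The two parts of the recursion are disjoint, as only sets from the second part meet
  \<open>L (Suc m)\<close>; there \<open>Z\<close> and \<open>V\<close> are recovered from
  \<open>Z \<union> V\<close> by cutting with that level. The level has \<open>Suc m\<close>
  elements, which accounts for the binomial coefficient in \<open>bracket\<close>.\<close>

lemma card_selections:
  "stacked m L \<Longrightarrow> finite (selections L k m) \<and> card (selections L k m) = bracket m k"
proof (induction L k m rule: selections.induct)
  case (3 L k m)
  let ?P = "selections L k m \<times> [L (Suc m)]\<^bsup>Suc k\<^esup>"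
  let ?h = "\<lambda>(Z, V). Z \<union> V :: nat set"
  have L: "finite (L (Suc m))" "card (L (Suc m)) = Suc m"
    using "3.prems" by (auto simp: stacked_def)
  have IH: "finite (selections L (Suc k) m)" "card (selections L (Suc k) m) = bracket m (Suc k)"
    "finite (selections L k m)" "card (selections L k m) = bracket m k"
    using "3.IH" stacked_Suc [OF "3.prems"] by auto
  have disj: "Z \<inter> L (Suc m) = {}" if "Z \<in> selections L j m" for Z j
  proof -
    have "\<Union>(L ` {1..m}) \<inter> L (Suc m) = {}"
      using stacked_index_unique [OF "3.prems"] by fastforce
    then show ?thesis
      using selections_subset [OF that] by blast
  qed
  have fin: "finite ?P"
    using IH(3) L(1) by (simp add: finite_imp_finite_nsets)
  have "inj_on ?h ?P"
  proof (rule inj_onI, clarify)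
    fix Z V Z' V'
    assume "Z \<in> selections L k m" "V \<in> [L (Suc m)]\<^bsup>Suc k\<^esup>"
      "Z' \<in> selections L k m" "V' \<in> [L (Suc m)]\<^bsup>Suc k\<^esup>" "Z \<union> V = Z' \<union> V'"
    then show "Z = Z' \<and> V = V'"
      using disj [of Z k] disj [of Z' k] unfolding nsets_def by blast
  qed
  then have card: "card (?h ` ?P) = bracket m k * (Suc m choose Suc k)"
    using IH L by (simp add: card_image card_cartesian_product)
  have "selections L (Suc k) m \<inter> ?h ` ?P = {}"
  proof -
    have "?h x \<inter> L (Suc m) \<noteq> {}" if "x \<in> ?P" for x
      using that by (auto simp: nsets_def) (metis Int_absorb2 Int_Un_distrib2 Un_empty card.empty old.nat.distinct(1))
    then show ?thesis
      using disj [of _ "Suc k"] by blast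
  qed
  then show ?case
    using IH fin card by (simp add: card_Un_disjoint bracket_Suc_Suc mult.commute)
qed simp_all

text \<open>Ties the recursion to \<open>subtriangles_iff\<close>. As \<open>f\<close> is
  increasing, \<open>f (Suc k)\<close> is its maximum: if it is \<open>Suc m\<close>, removing the
  last level leaves a selection from the first \<open>m\<close> levels; otherwise only those levels
  are used.\<close>

lemma selections_iff:
  "Z \<in> selections L k m \<longleftrightarrow>
    (\<exists>f U. strict_mono_on {1..k} f \<and> f \<in> {1..k} \<rightarrow> {1..m} \<and>
       (\<forall>i\<in>{1..k}. U i \<in> [L (f i)]\<^bsup>i\<^esup>) \<and> Z = \<Union>(U ` {1..k}))"
proof (induction L k m arbitrary: Z rule: selections.induct)
  case (1 L m)
  then show ?case
    by (auto simp: strict_mono_on_def)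
next
  case (2 L k)
  then show ?case
    by auto
next
  case (3 L k m)
  let ?R = "\<lambda>k m Z f U. strict_mono_on {1..k} f \<and> f \<in> {1..k} \<rightarrow> {1..m} \<and>
       (\<forall>i\<in>{1..k}. U i \<in> [L (f i)]\<^bsup>i\<^esup>) \<and> Z = \<Union>(U ` {1..k})"
  note IH1 = "3.IH"(1) [THEN iffD1] "3.IH"(1) [THEN iffD2]
  note IH2 = "3.IH"(2) [THEN iffD1] "3.IH"(2) [THEN iffD2]
  show ?case (is "_ \<longleftrightarrow> (\<exists>f U. ?R (Suc k) (Suc m) Z f U)")
  proof
    assume "Z \<in> selections L (Suc k) (Suc m)"
    then consider "Z \<in> selections L (Suc k) m"
      | Y V where "Y \<in> selections L k m" "V \<in> [L (Suc m)]\<^bsup>Suc k\<^esup>" "Z = Y \<union> V"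
      unfolding selections_Suc_Suc_iff by blast
    then show "\<exists>f U. ?R (Suc k) (Suc m) Z f U"
    proof cases
      case 1
      obtain f U where fU: "?R (Suc k) m Z f U"
        using IH1(1) [OF 1] by blast
      moreover have "f \<in> {1..Suc k} \<rightarrow> {1..Suc m}"
      proof
        fix i assume "i \<in> {1..Suc k}"
        then have "f i \<in> {1..m}"
          using fU by blast
        then show "f i \<in> {1..Suc m}"
          by simp
      qed
      ultimately show ?thesis
        by blast
    next
      case (2 Y V)
      obtain f U where fU: "?R k m Y f U"
        using IH2(1) [OF 2(1)] by blast
      let ?f = "f(Suc k := Suc m)" and ?U = "U(Suc k := V)"
      have lt: "f i < Suc m" if "i \<in> {1..k}" for i
        using fU that by (auto simp: Pi_iff less_Suc_eq_le)
      have "strict_mono_on {1..Suc k} ?f"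
        using fU lt by (auto simp: strict_mono_on_def le_Suc_eq)
      moreover have "?f \<in> {1..Suc k} \<rightarrow> {1..Suc m}"
        using fU by (auto simp: Pi_iff le_Suc_eq)
      moreover have "\<forall>i\<in>{1..Suc k}. ?U i \<in> [L (?f i)]\<^bsup>i\<^esup>"
        using fU 2 by (auto simp: le_Suc_eq)
      moreover have "Z = \<Union>(?U ` {1..Suc k})"
      proof -
        have "\<Union>(?U ` {1..Suc k}) = \<Union>(?U ` {1..k}) \<union> V"
          using UN_1_Suc [of ?U k] by simp
        also have "?U ` {1..k} = U ` {1..k}"
          by auto
        finally show ?thesis
          using fU 2 by simp
      qed
      ultimately show ?thesis
        by blast
    qed
  next
    assume "\<exists>f U. ?R (Suc k) (Suc m) Z f U"
    then obtain f U where fU: "?R (Suc k) (Suc m) Z f U"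
      by blast
    have mono: "f i < f (Suc k)" if "i \<in> {1..k}" for i
      using fU that by (auto simp: strict_mono_on_def)
    have top: "f (Suc k) \<le> Suc m"
      using fU by (auto simp: Pi_iff)
    show "Z \<in> selections L (Suc k) (Suc m)"
    proof (cases "f (Suc k) = Suc m")
      case True
      have "f \<in> {1..k} \<rightarrow> {1..m}"
        using fU mono True by (fastforce simp: Pi_iff)
      moreover have "strict_mono_on {1..k} f"
        using fU by (auto simp: strict_mono_on_def)
      ultimately have "?R k m (\<Union>(U ` {1..k})) f U"
        using fU by auto
      then have "\<Union>(U ` {1..k}) \<in> selections L k m"
        by (intro IH2(2) exI)
      moreover have "Z = \<Union>(U ` {1..k}) \<union> U (Suc k)"
        using fU UN_1_Suc [of U k] by (metis)
      moreover have "U (Suc k) \<in> [L (Suc m)]\<^bsup>Suc k\<^esup>"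
        using fU True [symmetric] by simp
      ultimately show ?thesis
        unfolding selections_Suc_Suc_iff by blast
    next
      case False
      have "f \<in> {1..Suc k} \<rightarrow> {1..m}"
      proof
        fix i assume i: "i \<in> {1..Suc k}"
        have "f i \<ge> 1"
          using fU i by (auto simp: Pi_iff)
        moreover have "f i \<le> f (Suc k)"
          using mono [of i] i by (cases "i = Suc k") auto
        ultimately show "f i \<in> {1..m}"
          using top False by simp
      qed
      then have "?R (Suc k) m Z f U"
        using fU by blast
      then have "Z \<in> selections L (Suc k) m"
        by (intro IH1(2) exI)
      then show ?thesis
        by simp
    qed
  qed
qed

lemma subtriangles_eq_selections:
  "B \<in> triangles m \<Longrightarrow> subtriangles k m B = selections (level B) k m"
  by (rule set_eqI) (simp only: subtriangles_iff selections_iff)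

lemma finite_subtriangles: "B \<in> triangles m \<Longrightarrow> finite (subtriangles k m B)"
  and card_subtriangles: "B \<in> triangles m \<Longrightarrow> card (subtriangles k m B) = bracket m k"
  using card_selections [OF level_stacked] by (simp_all add: subtriangles_eq_selections)

section \<open>Product Ramsey theorem\<close>

text \<open>An element of the product of the families of \<open>e i\<close>-subsets of \<open>A i\<close> is encoded by its union \<open>W\<close>;
  this is faithful because the sets \<open>A i\<close> are disjoint.\<close>

definition homogeneous ::
    "nat \<Rightarrow> (nat \<Rightarrow> nat) \<Rightarrow> (nat \<Rightarrow> 'a set) \<Rightarrow> ('a set \<Rightarrow> bool) \<Rightarrow> bool" where
  "homogeneous N e A c \<longleftrightarrow>
     (\<exists>d. \<forall>W. W \<subseteq> \<Union>(A ` {..<N}) \<and> (\<forall>i<N. card (W \<inter> A i) = e i) \<longrightarrow> c W = d)"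

text \<open>By disjointness \<open>W \<inter> A i = W \<inter> A' i\<close> for every
  \<open>W\<close> inside the smaller sets, so each \<open>W\<close> tested for \<open>A'\<close> is
  also tested for \<open>A\<close>.\<close>

lemma homogeneous_subset:
  assumes "homogeneous N e A c" "disjoint_family_on A {..<N}" "\<And>i. i < N \<Longrightarrow> A' i \<subseteq> A i"
  shows "homogeneous N e A' c"
proof -
  obtain d where d: "\<And>W. W \<subseteq> \<Union>(A ` {..<N}) \<Longrightarrow> \<forall>i<N. card (W \<inter> A i) = e i \<Longrightarrow> c W = d"
    using assms(1) by (auto simp: homogeneous_def)
  have "c W = d" if W: "W \<subseteq> \<Union>(A' ` {..<N})" "\<forall>i<N. card (W \<inter> A' i) = e i" for W
  proof (rule d)
    show "W \<subseteq> \<Union>(A ` {..<N})"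
      using W(1) assms(3) by fastforce
    have "W \<inter> A i = W \<inter> A' i" if "i < N" for i
    proof
      show "W \<inter> A i \<subseteq> W \<inter> A' i"
      proof
        fix x assume x: "x \<in> W \<inter> A i"
        then obtain j where j: "j < N" "x \<in> A' j"
          using W(1) by blast
        then have "x \<in> A j \<inter> A i"
          using assms(3) [of j] x by blast
        then have "j = i"
          using assms(2) j(1) \<open>i < N\<close> unfolding disjoint_family_on_def by blast
        then show "x \<in> W \<inter> A' i"
          using j x by blast
      qed
      show "W \<inter> A' i \<subseteq> W \<inter> A i"
        using assms(3) [OF that] by blast
    qed
    then show "\<forall>i<N. card (W \<inter> A i) = e i"
      using W(2) by simp
  qed
  then show ?thesis
    unfolding homogeneous_def by (intro exI [of _ d] allI impI) blast
qed

lemma nsets_nonempty: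
  assumes "finite A" "n \<le> card A"
  obtains B where "B \<in> [A]\<^bsup>n\<^esup>"
  using assms nsets_eq_empty_iff [of A n] by (metis all_not_in_conv not_less)

text \<open>Shrink once for each colouring; homogeneity already achieved survives by
  \<open>homogeneous_subset\<close>. The case of one colouring is a hypothesis so that the lemma
  applies both to the induction hypothesis of \<open>product_ramsey\<close> and to
  \<open>product_ramsey\<close> itself.\<close>

lemma simultaneous_product_ramsey:
  fixes e :: "'j \<Rightarrow> nat \<Rightarrow> nat"
  assumes single: "\<And>e s. \<exists>M. \<forall>A c. disjoint_family_on A {..<N} \<longrightarrow>
      (\<forall>i<N. finite (A i) \<and> M \<le> card (A i)) \<longrightarrow>
      (\<exists>A'::nat \<Rightarrow> 'a set. (\<forall>i<N. A' i \<in> [A i]\<^bsup>s\<^esup>) \<and> homogeneous N e A' c)"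
    and "finite J"
  shows "\<exists>M. \<forall>A c. disjoint_family_on A {..<N} \<longrightarrow>
      (\<forall>i<N. finite (A i) \<and> M \<le> card (A i)) \<longrightarrow>
      (\<exists>A'::nat \<Rightarrow> 'a set. (\<forall>i<N. A' i \<in> [A i]\<^bsup>s\<^esup>) \<and> (\<forall>j\<in>J. homogeneous N (e j) A' (c j)))"
  using \<open>finite J\<close>
proof (induction J rule: finite_induct)
  case empty
  have "\<exists>A'. \<forall>i<N. A' i \<in> [A i]\<^bsup>s\<^esup>" if "\<forall>i<N. finite (A i) \<and> s \<le> card (A i)" for A :: "nat \<Rightarrow> 'a set"
  proof -
    have "\<exists>B. B \<in> [A i]\<^bsup>s\<^esup>" if "i < N" for i
      using nsets_nonempty [of "A i" s] \<open>\<forall>i<N. finite (A i) \<and> s \<le> card (A i)\<close> that by metis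
    then show ?thesis
      by metis
  qed
  then show ?case
    by auto
next
  case (insert x J)
  obtain M1 where M1: "\<And>A c. disjoint_family_on A {..<N} \<Longrightarrow>
      (\<forall>i<N. finite (A i) \<and> M1 \<le> card (A i)) \<Longrightarrow>
      (\<exists>A'::nat \<Rightarrow> 'a set. (\<forall>i<N. A' i \<in> [A i]\<^bsup>s\<^esup>) \<and> (\<forall>j\<in>J. homogeneous N (e j) A' (c j)))"
    using insert.IH by metis
  \<comment> \<open>Making colouring \<open>x\<close> constant must leave \<open>M1\<close> elements
    in each set, enough to treat the colourings in \<open>J\<close> afterwards.\<close>
  obtain M where M: "\<And>A c. disjoint_family_on A {..<N} \<Longrightarrow>
      (\<forall>i<N. finite (A i) \<and> M \<le> card (A i)) \<Longrightarrow>
      (\<exists>A'::nat \<Rightarrow> 'a set. (\<forall>i<N. A' i \<in> [A i]\<^bsup>M1\<^esup>) \<and> homogeneous N (e x) A' c)"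
    using single [of M1 "e x"] by metis
  have "\<exists>A'. (\<forall>i<N. A' i \<in> [A i]\<^bsup>s\<^esup>) \<and> (\<forall>j\<in>insert x J. homogeneous N (e j) A' (c j))"
    if A: "disjoint_family_on A {..<N}" "\<forall>i<N. finite (A i) \<and> M \<le> card (A i)"
    for A :: "nat \<Rightarrow> 'a set" and c
  proof -
    obtain A1 where A1: "\<forall>i<N. A1 i \<in> [A i]\<^bsup>M1\<^esup>" "homogeneous N (e x) A1 (c x)"
      using M [OF A] by blast
    have dis: "disjoint_family_on A1 {..<N}"
      using A(1) A1(1) unfolding disjoint_family_on_def nsets_def by blast
    obtain A' where A': "\<forall>i<N. A' i \<in> [A1 i]\<^bsup>s\<^esup>" "\<forall>j\<in>J. homogeneous N (e j) A' (c j)"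
      using M1 [OF dis, of c] A1(1) by (auto simp: nsets_def)
    have "homogeneous N (e x) A' (c x)"
      using homogeneous_subset [OF A1(2) dis] A'(1) by (auto simp: nsets_def)
    moreover have "\<forall>i<N. A' i \<in> [A i]\<^bsup>s\<^esup>"
      using A'(1) A1(1) unfolding nsets_def by blast
    ultimately show ?thesis
      using A'(2) by blast
  qed
  then show ?case
    by blast
qed

text \<open>Transfers the two-colour Ramsey theorem from \<open>{..<R}\<close> to \<open>A\<close>
  along an injection.\<close>

lemma ramsey_bool:
  "\<exists>R::nat. \<forall>(A::'a set) c. finite A \<longrightarrow> R \<le> card A \<longrightarrow>
     (\<exists>H\<in>[A]\<^bsup>p\<^esup>. \<forall>V\<in>[H]\<^bsup>r\<^esup>. c V) \<or> (\<exists>H\<in>[A]\<^bsup>q\<^esup>. \<forall>V\<in>[H]\<^bsup>r\<^esup>. \<not> c V)"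
proof -
  obtain R :: nat where R: "partn_lst {..<R} [p, q] r"
    using ramsey2_full by blast
  have "(\<exists>H\<in>[A]\<^bsup>p\<^esup>. \<forall>V\<in>[H]\<^bsup>r\<^esup>. c V) \<or> (\<exists>H\<in>[A]\<^bsup>q\<^esup>. \<forall>V\<in>[H]\<^bsup>r\<^esup>. \<not> c V)"
    if A: "finite A" "R \<le> card A" for A :: "'a set" and c
  proof -
    obtain h where h: "inj_on h {..<R}" "h ` {..<R} \<subseteq> A"
      using card_le_inj [of "{..<R}" A] A by auto
    \<comment> \<open>Colour 0 means that \<open>c\<close> holds, so the size \<open>p\<close> at
      position 0 of \<open>[p, q]\<close> belongs to it.\<close>
    let ?f = "\<lambda>V. if c (h ` V) then 0 else 1 :: nat"
    have "?f \<in> [{..<R}]\<^bsup>r\<^esup> \<rightarrow> {..<2}"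
      by auto
    then obtain i H where i: "i < 2" and H: "H \<in> nsets {..<R} ([p, q] ! i)" and col: "?f ` [H]\<^bsup>r\<^esup> \<subseteq> {i}"
      using partn_lstE [OF R, of ?f 2] by (auto simp: numeral_2_eq_2)
    have sub: "H \<subseteq> {..<R}"
      using H by (simp add: nsets_def)
    have inj: "inj_on h H"
      using inj_on_subset [OF h(1) sub] .
    have image: "h ` H \<in> nsets A ([p, q] ! i)"
      using H h(2) sub inj by (auto simp: nsets_def card_image)
    have "?f V = i" if "V \<in> [H]\<^bsup>r\<^esup>" for V
      using col that by blast
    then have col': "c V \<longleftrightarrow> i = 0" if "V \<in> [h ` H]\<^bsup>r\<^esup>" for V
      using nset_image_obtains [OF that inj] by (metis zero_neq_one)
    show ?thesis
    proof (cases "i = 0")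
      case True
      then have "h ` H \<in> [A]\<^bsup>p\<^esup>" "\<forall>V\<in>[h ` H]\<^bsup>r\<^esup>. c V"
        using image col' by auto
      then show ?thesis
        by blast
    next
      case False
      then have "h ` H \<in> [A]\<^bsup>q\<^esup>" "\<forall>V\<in>[h ` H]\<^bsup>r\<^esup>. \<not> c V"
        using image col' i by (auto simp: less_2_cases_iff)
      then show ?thesis
        by blast
    qed
  qed
  then show ?thesis
    by blast
qed

text \<open>Shrink the last level first: once it has bounded size, its finitely many subsets give finitely
  many colourings of the other levels, to be made constant simultaneously.\<close>

lemma product_ramsey:
  "\<exists>M. \<forall>A c. disjoint_family_on A {..<N} \<longrightarrow> (\<forall>i<N. finite (A i) \<and> M \<le> card (A i)) \<longrightarrow>
     (\<exists>A'::nat \<Rightarrow> 'a set. (\<forall>i<N. A' i \<in> [A i]\<^bsup>s\<^esup>) \<and> homogeneous N e A' c)"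
proof (induction N arbitrary: e s)
  case 0
  then show ?case
    by (auto simp: homogeneous_def)
next
  case (Suc N)
  obtain R :: nat where R: "\<And>(B::'a set) d. finite B \<Longrightarrow> R \<le> card B \<Longrightarrow>
      (\<exists>H\<in>[B]\<^bsup>s\<^esup>. \<forall>V\<in>[H]\<^bsup>e N\<^esup>. d V) \<or> (\<exists>H\<in>[B]\<^bsup>s\<^esup>. \<forall>V\<in>[H]\<^bsup>e N\<^esup>. \<not> d V)"
    using ramsey_bool [of s "e N" s, where ?'a = 'a] by metis
  \<comment> \<open>\<open>M\<close> has to be fixed before the sets \<open>A\<close> are known, so
    the colourings coming from the last set are indexed by numbers below \<open>t\<close>, the
    number of \<open>e N\<close>-subsets of an \<open>R\<close>-element set.\<close>
  define t where "t = (R choose e N)"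
  obtain M where M: "\<And>A c. disjoint_family_on A {..<N} \<Longrightarrow>
      (\<forall>i<N. finite (A i) \<and> M \<le> card (A i)) \<Longrightarrow>
      (\<exists>A'::nat \<Rightarrow> 'a set. (\<forall>i<N. A' i \<in> [A i]\<^bsup>s\<^esup>) \<and> (\<forall>j\<in>{..<t}. homogeneous N e A' (c j)))"
    using simultaneous_product_ramsey [OF Suc.IH, of "{..<t}" s "\<lambda>_. e"] by (metis finite_lessThan)
  have "\<exists>A'. (\<forall>i<Suc N. A' i \<in> [A i]\<^bsup>s\<^esup>) \<and> homogeneous (Suc N) e A' c"
    if A: "disjoint_family_on A {..<Suc N}" "\<forall>i<Suc N. finite (A i) \<and> max M R \<le> card (A i)"
    for A :: "nat \<Rightarrow> 'a set" and c
  proof -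
    obtain B where B: "B \<in> [A N]\<^bsup>R\<^esup>"
      using nsets_nonempty [of "A N" R] A(2) by auto
    then have finB: "finite B" "card B = R"
      by (auto simp: nsets_def)
    then have "finite ([B]\<^bsup>e N\<^esup>)" "card ([B]\<^bsup>e N\<^esup>) = t"
      by (simp_all add: finite_imp_finite_nsets t_def)
    then obtain v where v: "v ` {..<t} = [B]\<^bsup>e N\<^esup>"
      using ex_bij_betw_nat_finite [of "[B]\<^bsup>e N\<^esup>"] by (auto simp: bij_betw_def atLeast0LessThan)
    have "disjoint_family_on A {..<N}" "\<forall>i<N. finite (A i) \<and> M \<le> card (A i)"
      using A by (auto simp: disjoint_family_on_def)
    then obtain A' where A': "\<forall>i<N. A' i \<in> [A i]\<^bsup>s\<^esup>"
      "\<forall>j\<in>{..<t}. homogeneous N e A' (\<lambda>W. c (W \<union> v j))"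
      using M [of A "\<lambda>j W. c (W \<union> v j)"] by blast
    have "\<forall>V\<in>[B]\<^bsup>e N\<^esup>. homogeneous N e A' (\<lambda>W. c (W \<union> V))"
      unfolding v [symmetric] using A'(2) by blast
    \<comment> \<open>The colour of \<open>W \<union> V\<close> now depends only on
      \<open>V\<close>, so \<open>d\<close> is a colouring of the \<open>e N\<close>-subsets of
      \<open>B\<close>.\<close>
    then obtain d where d: "\<And>V W. V \<in> [B]\<^bsup>e N\<^esup> \<Longrightarrow> W \<subseteq> \<Union>(A' ` {..<N}) \<Longrightarrow>
        \<forall>i<N. card (W \<inter> A' i) = e i \<Longrightarrow> c (W \<union> V) = d V"
      unfolding homogeneous_def by metis
    \<comment> \<open>By the choice of \<open>R\<close>, the last set shrinks to one on which
      \<open>d\<close> is constant.\<close>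
    obtain H b where H: "H \<in> [B]\<^bsup>s\<^esup>" "\<And>V. V \<in> [H]\<^bsup>e N\<^esup> \<Longrightarrow> d V = b"
      using R [of B d] finB by (metis order_refl)
    let ?A = "A'(N := H)"
    have "c W = b" if W: "W \<subseteq> \<Union>(?A ` {..<Suc N})" "\<forall>i<Suc N. card (W \<inter> ?A i) = e i" for W
    proof -
      let ?W = "W \<inter> \<Union>(A' ` {..<N})" and ?V = "W \<inter> H"
      have "?W \<inter> A' i = W \<inter> ?A i" if "i < N" for i
        using that by auto
      then have "\<forall>i<N. card (?W \<inter> A' i) = e i"
        using W(2) by (metis less_SucI)
      moreover have V: "?V \<in> [H]\<^bsup>e N\<^esup>"
        using W(2) H(1) by (auto simp: nsets_def)
      then have "?V \<in> [B]\<^bsup>e N\<^esup>"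
        using H(1) by (auto simp: nsets_def)
      ultimately have "c (?W \<union> ?V) = d ?V"
        by (intro d) auto
      moreover have "\<Union>(?A ` {..<Suc N}) = \<Union>(A' ` {..<N}) \<union> H"
        by (auto simp: less_Suc_eq)
      then have "W \<subseteq> \<Union>(A' ` {..<N}) \<union> H"
        using W(1) by simp
      then have "?W \<union> ?V = W"
        by blast
      ultimately show ?thesis
        using H(2) [OF V] by simp
    qed
    then have "homogeneous (Suc N) e ?A c"
      unfolding homogeneous_def by (intro exI [of _ b] allI impI) blast
    moreover have "\<forall>i<Suc N. ?A i \<in> [A i]\<^bsup>s\<^esup>"
      using A'(1) H(1) B by (auto simp: less_Suc_eq nsets_def)
    ultimately show ?thesis
      by blast
  qed
  then show ?case
    by blast
qed

section \<open>Ramsey theorem for triangles\<close>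

lemma ex_strict_mono_enumeration:
  assumes "H \<in> [A::nat set]\<^bsup>r\<^esup>"
  obtains h where "strict_mono_on {1..r} h" "h ` {1..r} = H"
proof -
  \<comment> \<open>List positions start at 0 and levels at 1, hence \<open>i - 1\<close>.\<close>
  let ?xs = "sorted_list_of_set H" and ?h = "\<lambda>i. sorted_list_of_set H ! (i - 1)"
  have H: "finite H" "length ?xs = r"
    using assms by (simp_all add: nsets_def)
  have "strict_mono_on {1..r} ?h"
    using H by (auto simp: strict_mono_on_def intro!: sorted_wrt_nth_less [OF strict_sorted_list_of_set])
  moreover have "?h ` {1..r} = H"
  proof -
    have "?h ` {1..r} = (!) ?xs ` (\<lambda>i. i - 1) ` {1..r}"
      by (simp add: image_image)
    also have "(\<lambda>i. i - 1) ` {1..r} = {0..<r}"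
      by (force simp: image_iff intro: bexI [of _ "Suc _"])
    also have "(!) ?xs ` {0..<r} = H"
      using H nth_image [of r ?xs] by (simp add: atLeast0LessThan)
    finally show ?thesis .
  qed
  ultimately show thesis
    using that by blast
qed

text \<open>A triangle meeting exactly the levels in \<open>S\<close> has \<open>rank S j\<close> elements in level \<open>j\<close>.\<close>

definition rank :: "nat set \<Rightarrow> nat \<Rightarrow> nat" where
  "rank S j = (if j \<in> S then card {i \<in> S. i \<le> j} else 0)"

text \<open>As \<open>g\<close> preserves order, exactly \<open>g 1, ..., g i\<close> are at most
  \<open>g i\<close>. Thus \<open>rank\<close> returns the size of the triangle level that
  \<open>g\<close> places there.\<close>

lemma rank_strict_mono_image:
  assumes "strict_mono_on {1..k} g" "i \<in> {1..k}"
  shows "rank (g ` {1..k}) (g i) = i"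
proof -
  have "g a \<le> g i \<longleftrightarrow> a \<le> i" if "a \<in> {1..k}" for a
    using assms that unfolding strict_mono_on_def by (metis le_less_linear less_le_not_le order_le_less)
  then have "{j \<in> g ` {1..k}. j \<le> g i} = g ` {1..i}"
    using assms(2) by auto
  moreover have "inj_on g {1..i}"
    by (rule inj_on_subset [OF strict_mono_on_imp_inj_on [OF assms(1)]]) (use assms(2) in auto)
  ultimately show ?thesis
    using assms(2) by (simp add: rank_def card_image)
qed

text \<open>\<open>Z\<close> takes its level \<open>i\<close> from \<open>A (h i)\<close>, where
  \<open>h\<close> lists \<open>H\<close> increasingly; \<open>r \<le> s\<close> leaves enough
  elements. The triangles below \<open>Z\<close> then have the form on which homogeneity for
  \<open>rank S\<close> fixes the colour. The first \<open>M\<close> levels are skipped, and the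
  sets \<open>A i\<close> are numbered from 0 but levels from 1, hence
  \<open>Suc (M + i)\<close>.\<close>

lemma subtriangle_in_levels:
  assumes B: "B \<in> triangles m" and m: "M + N \<le> m"
    and A: "\<And>i. i < N \<Longrightarrow> A i \<in> [level B (Suc (M + i))]\<^bsup>s\<^esup>"
    and H: "H \<in> [{..<N}]\<^bsup>r\<^esup>" and "r \<le> s"
  obtains Z where "Z \<in> subtriangles r m B"
    and "\<And>k W. W \<in> subtriangles k r Z \<Longrightarrow> \<exists>S\<in>[H]\<^bsup>k\<^esup>.
       W \<subseteq> \<Union>(A ` {..<N}) \<and> (\<forall>j<N. card (W \<inter> A j) = rank S j)"
proof -
  obtain h where h: "strict_mono_on {1..r} h" "h ` {1..r} = H"
    using ex_strict_mono_enumeration [OF H] .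
  have hN: "h i < N" if "i \<in> {1..r}" for i
  proof -
    have "h i \<in> H" "H \<subseteq> {..<N}"
      using h(2) H that by (auto simp: nsets_def)
    then show ?thesis
      by blast
  qed
  have "\<exists>V. V \<in> [A (h i)]\<^bsup>i\<^esup>" if i: "i \<in> {1..r}" for i
  proof -
    have "finite (A (h i))" "i \<le> card (A (h i))"
      using A [OF hN [OF i]] i \<open>r \<le> s\<close> by (auto simp: nsets_def)
    then show ?thesis
      by (meson nsets_nonempty)
  qed
  then obtain V where V: "\<And>i. i \<in> {1..r} \<Longrightarrow> V i \<in> [A (h i)]\<^bsup>i\<^esup>"
    by metis
  let ?Z = "\<Union>(V ` {1..r})" and ?h = "\<lambda>i. Suc (M + h i)"
  have mono: "strict_mono_on {1..r} ?h"
    using h(1) by (simp add: strict_mono_on_def)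
  have range: "?h \<in> {1..r} \<rightarrow> {1..m}"
    using hN m by fastforce
  have VB: "V i \<in> [level B (?h i)]\<^bsup>i\<^esup>" if "i \<in> {1..r}" for i
    using V [OF that] A [OF hN [OF that]] by (auto simp: nsets_def)
  have Z: "?Z \<in> subtriangles r m B"
    unfolding subtriangles_iff [OF B] using mono range VB by blast
  have St: "stacked r V"
    using stacked_refine [OF level_stacked [OF B] mono range VB] .
  have "\<exists>S\<in>[H]\<^bsup>k\<^esup>. W \<subseteq> \<Union>(A ` {..<N}) \<and> (\<forall>j<N. card (W \<inter> A j) = rank S j)"
    if W: "W \<in> subtriangles k r ?Z" for k W
  proof -
    have Zr: "?Z \<in> triangles r"
      using UN_stacked(1) [OF St] .
    obtain f U where f: "strict_mono_on {1..k} f" "f \<in> {1..k} \<rightarrow> {1..r}"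
      and U: "\<And>i. i \<in> {1..k} \<Longrightarrow> U i \<in> [level ?Z (f i)]\<^bsup>i\<^esup>" and WU: "W = \<Union>(U ` {1..k})"
      using W unfolding subtriangles_iff [OF Zr] by blast
    \<comment> \<open>Level \<open>i\<close> of \<open>W\<close> lies in level \<open>f i\<close> of
      \<open>Z\<close>, hence in \<open>A (h (f i))\<close>; the required \<open>S\<close> is the
      image of this map.\<close>
    let ?g = "\<lambda>i. h (f i)"
    have fr: "f i \<in> {1..r}" if "i \<in> {1..k}" for i
      using f(2) that by blast
    have gN: "?g i < N" if "i \<in> {1..k}" for i
      using hN [OF fr [OF that]] .
    have g: "strict_mono_on {1..k} ?g"
      using f(1) h(1) fr unfolding strict_mono_on_def by blast
    have UA: "U i \<subseteq> A (?g i)" if "i \<in> {1..k}" for i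
      using U [OF that] V [OF fr [OF that]] UN_stacked(2) [OF St fr [OF that]]
      by (auto simp: nsets_def)
    have sub: "W \<subseteq> \<Union>(A ` {..<N})"
      unfolding WU using UA gN by blast
    have uniq: "a = b" if "a < N" "b < N" "x \<in> A a" "x \<in> A b" for a b x
    proof -
      have "x \<in> level B (Suc (M + a))" "x \<in> level B (Suc (M + b))"
        using A [OF that(1)] A [OF that(2)] that(3,4) by (auto simp: nsets_def)
      then have "Suc (M + a) = Suc (M + b)"
        using that(1,2) m by (intro stacked_index_unique [OF level_stacked [OF B]]) auto
      then show ?thesis
        by simp
    qed
    have "card (W \<inter> A j) = rank (?g ` {1..k}) j" if j: "j < N" for j
    proof (cases "j \<in> ?g ` {1..k}")
      case True
      then obtain i where i: "i \<in> {1..k}" "j = ?g i"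
        by blast
      \<comment> \<open>The sets \<open>A\<close> are disjoint, so no other level of
        \<open>W\<close> meets \<open>A j\<close>.\<close>
      have "x \<in> U i" if x: "x \<in> W" "x \<in> A j" for x
      proof -
        obtain i' where i': "i' \<in> {1..k}" "x \<in> U i'"
          using x(1) WU by blast
        then have "?g i' = ?g i"
          using uniq [OF gN [OF i'(1)] j _ x(2)] UA [OF i'(1)] i(2) by blast
        then have "i' = i"
          using strict_mono_on_imp_inj_on [OF g] i(1) i'(1) by (auto dest: inj_onD)
        then show ?thesis
          using i'(2) by simp
      qed
      then have "W \<inter> A j = U i"
        using UA [OF i(1)] i WU by blast
      then show ?thesis
        using U [OF i(1)] rank_strict_mono_image [OF g i(1)] i(2) by (simp add: nsets_def)
    next
      case False
      have "x \<notin> A j" if x: "x \<in> W" for x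
      proof
        assume "x \<in> A j"
        obtain i where "i \<in> {1..k}" "x \<in> U i"
          using x WU by blast
        then have "?g i = j"
          using uniq [OF gN j _ \<open>x \<in> A j\<close>, of i] UA [of i] by blast
        then show False
          using False \<open>i \<in> {1..k}\<close> by blast
      qed
      then have "W \<inter> A j = {}"
        by blast
      then show ?thesis
        using False by (simp add: rank_def)
    qed
    moreover have "?g ` {1..k} \<in> [H]\<^bsup>k\<^esup>"
      using strict_mono_on_imp_inj_on [OF g] fr h(2) by (auto simp: nsets_def card_image)
    ultimately show ?thesis
      using sub by blast
  qed
  then show thesis
    using that [OF Z] by blast
qed

text \<open>\<open>M\<close> is large enough to turn a colouring of triangles into a colouring of
  \<open>k\<close>-subsets of \<open>N\<close> level indices, and \<open>N\<close> is large enough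
  for Ramsey's theorem to apply to the latter.\<close>

theorem triangle_ramsey:
  obtains m where "max p q \<le> m"
    and "\<And>B X Y. completed_game m k B X Y \<Longrightarrow> wins p k m B X \<or> wins q k m B Y"
proof -
  obtain N :: nat where N: "\<And>(A::nat set) c. finite A \<Longrightarrow> N \<le> card A \<Longrightarrow>
     (\<exists>H\<in>[A]\<^bsup>p\<^esup>. \<forall>V\<in>[H]\<^bsup>k\<^esup>. c V) \<or> (\<exists>H\<in>[A]\<^bsup>q\<^esup>. \<forall>V\<in>[H]\<^bsup>k\<^esup>. \<not> c V)"
    using ramsey_bool [of p k q, where ?'a = nat] by metis
  let ?J = "[{..<N}]\<^bsup>k\<^esup>"
  \<comment> \<open>All sets \<open>S\<close> will share one colouring, membership in
    \<open>X\<close>; what varies with \<open>S\<close> is the size pattern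
    \<open>rank S\<close>.\<close>
  obtain M where M: "\<And>A c. disjoint_family_on A {..<N} \<Longrightarrow>
      (\<forall>i<N. finite (A i) \<and> M \<le> card (A i)) \<Longrightarrow>
      (\<exists>A'::nat \<Rightarrow> nat set. (\<forall>i<N. A' i \<in> [A i]\<^bsup>max p q\<^esup>) \<and> (\<forall>S\<in>?J. homogeneous N (rank S) A' (c S)))"
    using simultaneous_product_ramsey [where N = N and J = ?J and s = "max p q" and e = rank, OF product_ramsey]
    by (metis finite_imp_finite_nsets finite_lessThan)
  \<comment> \<open>After \<open>M\<close> skipped levels, each of the next \<open>N\<close> levels
    has more than \<open>M\<close> elements; the last summand secures
    \<open>max p q \<le> ?m\<close>.\<close>
  let ?m = "M + N + max p q"
  have "wins p k ?m B X \<or> wins q k ?m B Y" if game: "completed_game ?m k B X Y" for B X Y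
  proof -
    have B: "B \<in> triangles ?m" and XY: "X \<union> Y = subtriangles k ?m B"
      using game by (auto simp: completed_game_def)
    let ?A = "\<lambda>i. level B (Suc (M + i))"
    note St = level_stacked [OF B]
    have "disjoint_family_on ?A {..<N}"
    proof -
      have "?A a \<inter> ?A b = {}" if "a < N" "b < N" "a \<noteq> b" for a b
        using that stacked_index_unique [OF St, of "Suc (M + a)" "Suc (M + b)"] by auto
      then show ?thesis
        by (auto simp: disjoint_family_on_def)
    qed
    moreover have "\<forall>i<N. finite (?A i) \<and> M \<le> card (?A i)"
      using stacked_finite [OF St] stacked_card [OF St] by auto
    ultimately obtain A' where A': "\<forall>i<N. A' i \<in> [?A i]\<^bsup>max p q\<^esup>"
      "\<forall>S\<in>?J. homogeneous N (rank S) A' (\<lambda>W. W \<in> X)"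
      using M [of ?A "\<lambda>_ W. W \<in> X"] by blast
    \<comment> \<open>\<open>d S\<close> is the common colour of the triangles whose levels lie in
      the sets \<open>A' i\<close> with \<open>i \<in> S\<close>.\<close>
    then obtain d where d: "\<And>S W. S \<in> ?J \<Longrightarrow> W \<subseteq> \<Union>(A' ` {..<N}) \<Longrightarrow>
        \<forall>i<N. card (W \<inter> A' i) = rank S i \<Longrightarrow> W \<in> X \<longleftrightarrow> d S"
      unfolding homogeneous_def by metis
    have Z: "\<exists>Z\<in>subtriangles r ?m B. \<forall>W\<in>subtriangles k r Z. W \<in> X \<longleftrightarrow> b"
      if H: "H \<in> [{..<N}]\<^bsup>r\<^esup>" "r \<le> max p q" "\<forall>V\<in>[H]\<^bsup>k\<^esup>. d V = b" for H r b
    proof -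
      obtain Z where Z: "Z \<in> subtriangles r ?m B"
        and S: "\<And>k W. W \<in> subtriangles k r Z \<Longrightarrow> \<exists>S\<in>[H]\<^bsup>k\<^esup>.
          W \<subseteq> \<Union>(A' ` {..<N}) \<and> (\<forall>j<N. card (W \<inter> A' j) = rank S j)"
        using subtriangle_in_levels [OF B, of M N A' "max p q" H r] A'(1) H(1,2) by auto
      have "[H]\<^bsup>k\<^esup> \<subseteq> ?J"
        using H(1) by (intro nsets_mono) (simp add: nsets_def)
      then have "W \<in> X \<longleftrightarrow> b" if "W \<in> subtriangles k r Z" for W
        using S [OF that] d H(3) by blast
      then show ?thesis
        using Z by blast
    qed
    have "(\<exists>H\<in>[{..<N}]\<^bsup>p\<^esup>. \<forall>V\<in>[H]\<^bsup>k\<^esup>. d V) \<or> (\<exists>H\<in>[{..<N}]\<^bsup>q\<^esup>. \<forall>V\<in>[H]\<^bsup>k\<^esup>. \<not> d V)"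
      by (intro N) auto
    then show ?thesis
    proof (elim disjE bexE)
      fix H assume "H \<in> [{..<N}]\<^bsup>p\<^esup>" "\<forall>V\<in>[H]\<^bsup>k\<^esup>. d V"
      then obtain Z where "Z \<in> subtriangles p ?m B" "\<forall>W\<in>subtriangles k p Z. W \<in> X"
        using Z [of H p True] by auto
      then show ?thesis
        unfolding wins_def by blast
    next
      fix H assume "H \<in> [{..<N}]\<^bsup>q\<^esup>" "\<forall>V\<in>[H]\<^bsup>k\<^esup>. \<not> d V"
      then obtain Z where "Z \<in> subtriangles q ?m B" "\<forall>W\<in>subtriangles k q Z. W \<notin> X"
        using Z [of H q False] by auto
      \<comment> \<open>A triangle outside \<open>X\<close> belongs to \<open>Y\<close> because it
        is a triangle of the board, by \<open>subtriangles_trans\<close>.\<close>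
      then show ?thesis
        unfolding wins_def using subtriangles_trans [of Z q ?m B k] XY by blast
    qed
  qed
  then show thesis
    using that [of ?m] by simp
qed

section \<open>Counting two-colourings\<close>

text \<open>Counts the colourings \<open>X\<close> that give all of \<open>T\<close> to the second
  player; the negative power of 2 is their proportion.\<close>

lemma card_Pow_minus:
  assumes "finite S" "T \<subseteq> S"
  shows "real (card (Pow (S - T))) = 2 ^ card S * 2 powi (- int (card T))"
proof -
  have "card T \<le> card S" "finite T"
    using assms by (auto intro: card_mono finite_subset)
  then have "real (card (Pow (S - T))) = 2 ^ (card S - card T)"
    using assms by (simp add: card_Pow card_Diff_subset)
  also have "\<dots> = 2 ^ card S * 2 powi (- int (card T))"
    using \<open>card T \<le> card S\<close> by (simp add: power_diff power_int_minus divide_inverse)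
  finally show ?thesis .
qed

text \<open>Complementation in \<open>S\<close> reduces this to
  \<open>card_Pow_minus\<close>.\<close>

lemma card_supersets:
  assumes "finite S" "T \<subseteq> S"
  shows "real (card {X. T \<subseteq> X \<and> X \<subseteq> S}) = 2 ^ card S * 2 powi (- int (card T))"
proof -
  have "bij_betw (\<lambda>X. S - X) {X. T \<subseteq> X \<and> X \<subseteq> S} (Pow (S - T))"
    using assms(2) by (intro bij_betwI [where g = "\<lambda>X. S - X"]) auto
  then show ?thesis
    using card_Pow_minus [OF assms] bij_betw_same_card by fastforce
qed

text \<open>Union bound in counting form: \<open>?F T\<close> holds the colourings in which the
  first player owns \<open>T\<close>, \<open>?G T\<close> those in which the second does, and
  together they do not exhaust \<open>Pow S\<close>.\<close>

lemma ex_two_colouring: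
  assumes "finite S" "finite P" "finite Q"
    and P: "\<And>T. T \<in> P \<Longrightarrow> T \<subseteq> S \<and> card T = a"
    and Q: "\<And>T. T \<in> Q \<Longrightarrow> T \<subseteq> S \<and> card T = b"
    and less: "real (card P) * 2 powi (- int a) + real (card Q) * 2 powi (- int b) < 1"
  obtains X where "X \<subseteq> S" "\<And>T. T \<in> P \<Longrightarrow> \<not> T \<subseteq> X" "\<And>T. T \<in> Q \<Longrightarrow> \<not> T \<subseteq> S - X"
proof -
  let ?F = "\<lambda>T. {X. T \<subseteq> X \<and> X \<subseteq> S}" and ?G = "\<lambda>T. Pow (S - T)"
  let ?n = "card S"
  have "real (card (\<Union>(?F ` P))) \<le> (\<Sum>T\<in>P. real (card (?F T)))"
    unfolding of_nat_sum [symmetric] of_nat_le_iff by (rule card_UN_le [OF \<open>finite P\<close>])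
  also have "\<dots> = (\<Sum>T\<in>P. 2 ^ ?n * 2 powi (- int a))"
    using P card_supersets [OF \<open>finite S\<close>] by (intro sum.cong) auto
  finally have F: "real (card (\<Union>(?F ` P))) \<le> 2 ^ ?n * (real (card P) * 2 powi (- int a))"
    by (simp add: mult_ac)
  have "real (card (\<Union>(?G ` Q))) \<le> (\<Sum>T\<in>Q. real (card (?G T)))"
    unfolding of_nat_sum [symmetric] of_nat_le_iff by (rule card_UN_le [OF \<open>finite Q\<close>])
  also have "\<dots> = (\<Sum>T\<in>Q. 2 ^ ?n * 2 powi (- int b))"
    using Q card_Pow_minus [OF \<open>finite S\<close>] by (intro sum.cong) auto
  finally have G: "real (card (\<Union>(?G ` Q))) \<le> 2 ^ ?n * (real (card Q) * 2 powi (- int b))"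
    by (simp add: mult_ac)
  have "real (card (\<Union>(?F ` P) \<union> \<Union>(?G ` Q))) \<le> real (card (\<Union>(?F ` P))) + real (card (\<Union>(?G ` Q)))"
    unfolding of_nat_add [symmetric] of_nat_le_iff by (rule card_Un_le)
  also have "\<dots> \<le> 2 ^ ?n * (real (card P) * 2 powi (- int a) + real (card Q) * 2 powi (- int b))"
    using F G by (simp add: distrib_left)
  also have "\<dots> < 2 ^ ?n * 1"
    using less by (intro mult_strict_left_mono) auto
  also have "\<dots> = real (card (Pow S))"
    using \<open>finite S\<close> by (simp add: card_Pow)
  finally have card: "card (\<Union>(?F ` P) \<union> \<Union>(?G ` Q)) < card (Pow S)"
    by (simp only: of_nat_less_iff)
  have fin: "finite (\<Union>(?F ` P) \<union> \<Union>(?G ` Q))"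
    by (rule finite_subset [of _ "Pow S"]) (use assms(1) in auto)
  have "\<not> Pow S \<subseteq> \<Union>(?F ` P) \<union> \<Union>(?G ` Q)"
    using card_mono [OF fin] card by (meson leD)
  then obtain X where X: "X \<in> Pow S" "X \<notin> \<Union>(?F ` P) \<union> \<Union>(?G ` Q)"
    by (meson subsetI)
  show thesis
  proof (rule that)
    show "X \<subseteq> S"
      using X(1) by simp
    show "\<not> T \<subseteq> X" if "T \<in> P" for T
      using X that by auto
    show "\<not> T \<subseteq> S - X" if "T \<in> Q" for T
    proof
      assume "T \<subseteq> S - X"
      then have "X \<in> ?G T"
        using X(1) by blast
      then show False
        using X(2) that by blast
    qed
  qed
qed

lemma ex_draw:
  assumes B: "B \<in> triangles m"
    and less: "real (bracket m p) * 2 powi (- int (bracket p k))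
       + real (bracket m q) * 2 powi (- int (bracket q k)) < 1"
  shows "\<exists>X Y. completed_game m k B X Y \<and> draw p q k m B X Y"
proof -
  let ?S = "subtriangles k m B"
  let ?F = "\<lambda>r. subtriangles k r ` subtriangles r m B"
  have F: "T \<subseteq> ?S \<and> card T = bracket r k" if T: "T \<in> ?F r" for T r
  proof -
    obtain Z where Z: "Z \<in> subtriangles r m B" "T = subtriangles k r Z"
      using T by blast
    then have "Z \<in> triangles r"
      by (simp add: subtriangles_def)
    then show ?thesis
      using Z subtriangles_trans card_subtriangles by blast
  qed
  \<comment> \<open>Different \<open>Z\<close> may have the same \<open>k\<close>-triangles, as
    happens for \<open>k = 0\<close>, so this is only an inequality.\<close>
  have card: "real (card (?F r)) \<le> real (bracket m r)" and fin: "finite (?F r)" for r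
    using card_image_le [OF finite_subtriangles [OF B]] finite_subtriangles [OF B]
    by (simp_all add: card_subtriangles [OF B, symmetric])
  have "real (card (?F p)) * 2 powi (- int (bracket p k))
      + real (card (?F q)) * 2 powi (- int (bracket q k)) < 1"
    by (rule le_less_trans [OF _ less]) (intro add_mono mult_right_mono card; simp)
  then obtain X where X: "X \<subseteq> ?S" "\<And>T. T \<in> ?F p \<Longrightarrow> \<not> T \<subseteq> X" "\<And>T. T \<in> ?F q \<Longrightarrow> \<not> T \<subseteq> ?S - X"
    using ex_two_colouring [OF finite_subtriangles [OF B] fin fin F F] by metis
  have "completed_game m k B X (?S - X)"
    using B X(1) by (auto simp: completed_game_def)
  moreover have "draw p q k m B X (?S - X)"
    unfolding draw_def wins_def using X(2,3) by blast
  ultimately show ?thesis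
    by blast
qed

section \<open>The bound on \<open>R1\<close>\<close>

theorem theorem9:
  fixes p q k m :: nat
  assumes "k \<le> p" and "p \<le> q" and "q \<le> m"
    and "real (bracket m p) * 2 powi (- int (bracket p k))
       + real (bracket m q) * 2 powi (- int (bracket q k)) < 1"
  shows "R1 p q k > m"
proof (rule ccontr)
  let ?P = "\<lambda>n. max p q \<le> n \<and> \<not> (\<exists>B X Y. completed_game n k B X Y \<and> draw p q k n B X Y)"
  define n where "n = R1 p q k"
  assume "\<not> m < R1 p q k"
  then have "n \<le> m"
    by (simp add: n_def)
  obtain n' where "?P n'"
    using triangle_ramsey [of p q k] unfolding draw_def by metis
  \<comment> \<open>The least number with the property has it too, so boards with \<open>n\<close>
    levels admit no draw; \<open>ex_draw\<close> will contradict this.\<close>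
  then have "?P n"
    unfolding n_def R1_def by (rule LeastI)
  moreover have "{..<tri n} \<in> triangles n"
    by (simp add: triangles_def)
  \<comment> \<open>The exponents do not depend on the board, and \<open>bracket\<close> grows with
    its first argument, so the hypothesis passes from \<open>m\<close> down to
    \<open>n\<close>.\<close>
  moreover have "real (bracket n p) * 2 powi (- int (bracket p k))
       + real (bracket n q) * 2 powi (- int (bracket q k)) < 1"
    by (rule le_less_trans [OF _ assms(4)])
      (intro add_mono mult_right_mono; simp add: bracket_mono [OF \<open>n \<le> m\<close>])
  ultimately show False
    using ex_draw [of "{..<tri n}" n p k q] by blast
qed

end
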